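(* Assume $\mathfrak b=\mathfrak d$. Then there exist subspaces $X_0$ and $X_1$ of $2^\omega$ such that all finite powers of $X_0$ and all finite powers of $X_1$ have the Menger property, whereas $X_0\times X_1$ does not have the Menger property.
   Context: $2^\omega$ is the Cantor space. A space $X$ has the Menger property if for every sequence $\langle u_n : n\in\omega\rangle$ of open covers of $X$ there exist finite subsets $v_n\subset u_n$ such that $\bigcup_{n\in\omega}v_n$ is a cover of $X$. For $f,g\in\omega^\omega$, $f\le^* g$ means $f(n)\le g(n)$ for all but finitely many $n$. $\mathfrak b$ is the minimal cardinality of a subset $A\subset\omega^\omega$ unbounded with respect to $\le^*$ (for every $x\in\omega^\omega$ some $a\in A$ satisfies $a\not\le^* x$), and $\mathfrak d$ is the minimal cardinality of a dominating subset $A\subset\omega^\omega$ (for every $x\in\omega^\omega$ there is $a\in A$ with $x\le^* a$). *)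

theory Defs
  imports "HOL-Analysis.Analysis"
begin

definition le_star :: "(nat \<Rightarrow> nat) \<Rightarrow> (nat \<Rightarrow> nat) \<Rightarrow> bool" where
  "le_star f g \<longleftrightarrow> (\<forall>\<^sub>F n in sequentially. f n \<le> g n)"

definition unbounded_family :: "(nat \<Rightarrow> nat) set \<Rightarrow> bool" where
  "unbounded_family A \<longleftrightarrow> (\<forall>x. \<exists>a\<in>A. \<not> le_star a x)"

definition dominating_family :: "(nat \<Rightarrow> nat) set \<Rightarrow> bool" where
  "dominating_family A \<longleftrightarrow> (\<forall>x. \<exists>a\<in>A. le_star x a)"

definition b_eq_d :: bool where
  "b_eq_d \<longleftrightarrow> (\<exists>A D. unbounded_family A \<and> dominating_family D \<and>
      (\<forall>A'. unbounded_family A' \<longrightarrow> (card_of A, card_of A') \<in> ordLeq) \<and>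
      (\<forall>D'. dominating_family D' \<longrightarrow> (card_of D, card_of D') \<in> ordLeq) \<and>
      (card_of A, card_of D) \<in> ordIso)"

definition cantor_space :: "(nat \<Rightarrow> bool) topology" where
  "cantor_space = product_topology (\<lambda>_. discrete_topology UNIV) UNIV"

definition menger :: "'a topology \<Rightarrow> bool" where
  "menger T \<longleftrightarrow>
     (\<forall>u :: nat \<Rightarrow> 'a set set.
        (\<forall>n. (\<forall>U\<in>u n. openin T U) \<and> topspace T \<subseteq> \<Union>(u n)) \<longrightarrow>
        (\<exists>v. (\<forall>n. finite (v n) \<and> v n \<subseteq> u n) \<and> topspace T \<subseteq> (\<Union>n. \<Union>(v n))))"

end

(* Both spaces consist of a common set S of size d together with countably many points:
   X_c = S Un {x. x j = c for almost all j}, so that X_False Int X_True = S sits in the product as a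
   closed subset (the diagonal), and S is not Menger because the lengths of the blocks of its
   members are dominating.

   Each member of S is the characteristic function of every other block of an interval partition
   with knots a_(k+1) = h (h a_k). For each c the sets A_d of those n for which the d-th member is
   constant c on [n, h_d n) are made to generate a proper filter: along a well-order of type d = b,
   the function h_d can be chosen to dominate the next-element functions of all (fewer than b)
   finite intersections of earlier sets, and then some block of either parity contains [m, h_d m)
   for an m in the intersection, infinitely often.

   For the powers of X_c: given open covers u_n, finitely many members of u_n cover all matrices
   constant c beyond n, hence also every point whose coordinates are all c on [n, g n) for a suitable
   g. By the filter this misses only points with a coordinate in a part of S of size < b, which are
   handled by induction on the exponent, since unions of fewer than b Menger spaces are Menger. *)

theory Submission
  imports Defs
begin

section \<open>Covers, continuous images, and unions of fewer than b Menger spaces\<close>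

section \<open>The Menger property\<close>

text \<open>With the function-space instances this makes
  \<open>nat \<Rightarrow> nat \<Rightarrow> bool\<close> second countable, so that open covers of
  sets of matrices can be thinned to countable ones.\<close>

instance bool :: second_countable_topology
  by standard (auto simp: open_bool_def intro!: exI[of _ "range lessThan \<union> range greaterThan"])

lemma cantor_space_eq_euclidean: "cantor_space = euclidean"
proof -
  have "discrete_topology UNIV = (euclidean :: bool topology)"
    by (simp add: topology_eq open_discrete)
  then show ?thesis
    by (simp add: cantor_space_def euclidean_product_topology)
qed

lemma menger_continuous_map_image:
  assumes "menger T" and f: "continuous_map T T' f" and surj: "topspace T' \<subseteq> f ` topspace T"
  shows "menger T'"
  unfolding menger_def
proof (intro allI impI)
  fix u :: "nat \<Rightarrow> 'b set set"
  assume u: "\<forall>n. (\<forall>U\<in>u n. openin T' U) \<and> topspace T' \<subseteq> \<Union>(u n)"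
  define pre where "pre U = {x \<in> topspace T. f x \<in> U}" for U
  have "\<forall>n. (\<forall>U\<in>pre ` u n. openin T U) \<and> topspace T \<subseteq> \<Union>(pre ` u n)"
  proof (intro allI conjI)
    fix n
    show "\<forall>U\<in>pre ` u n. openin T U"
      using u f by (auto simp: pre_def continuous_map_def)
    show "topspace T \<subseteq> \<Union>(pre ` u n)"
    proof
      fix x assume x: "x \<in> topspace T"
      then have "f x \<in> topspace T'" using f by (auto simp: continuous_map_def)
      then obtain U where "U \<in> u n" "f x \<in> U" using u by blast
      with x show "x \<in> \<Union>(pre ` u n)" by (auto simp: pre_def)
    qed
  qed
  from \<open>menger T\<close>[unfolded menger_def, THEN spec, of "\<lambda>n. pre ` u n", THEN mp, OF this]
  obtain v where v: "\<forall>n. finite (v n) \<and> v n \<subseteq> pre ` u n" "topspace T \<subseteq> (\<Union>n. \<Union>(v n))"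
    by (elim exE conjE)
  have "\<exists>w. \<forall>n. w n \<subseteq> u n \<and> finite (w n) \<and> v n = pre ` w n"
    using v(1) by (intro choice allI) (metis finite_subset_image)
  then obtain w where w: "\<And>n. w n \<subseteq> u n \<and> finite (w n) \<and> v n = pre ` w n"
    by blast
  have "topspace T' \<subseteq> (\<Union>n. \<Union>(w n))"
  proof
    fix y assume "y \<in> topspace T'"
    then obtain x where x: "x \<in> topspace T" "y = f x" using surj by blast
    then obtain n V where "V \<in> v n" "x \<in> V" using v(2) by blast
    then show "y \<in> (\<Union>n. \<Union>(w n))" using w[of n] x by (auto simp: pre_def)
  qed
  then show "\<exists>v. (\<forall>n. finite (v n) \<and> v n \<subseteq> u n) \<and> topspace T' \<subseteq> (\<Union>n. \<Union>(v n))"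
    using w by (intro exI[of _ w] conjI allI) simp_all
qed

text \<open>Traces on \<open>Y\<close> and open extensions translate the two kinds of covers into
  each other; all later covering arguments use open sets of the whole space.\<close>

lemma menger_top_of_set:
  fixes Y :: "'a::topological_space set"
  shows "menger (top_of_set Y) \<longleftrightarrow>
    (\<forall>u. (\<forall>n. (\<forall>U\<in>u n. open U) \<and> Y \<subseteq> \<Union>(u n)) \<longrightarrow>
      (\<exists>v. (\<forall>n::nat. finite (v n) \<and> v n \<subseteq> u n) \<and> Y \<subseteq> (\<Union>n. \<Union>(v n))))"
    (is "_ \<longleftrightarrow> ?rhs")
proof
  assume M: "menger (top_of_set Y)"
  show ?rhs
  proof (intro allI impI)
    fix u :: "nat \<Rightarrow> 'a set set"
    assume u: "\<forall>n. (\<forall>U\<in>u n. open U) \<and> Y \<subseteq> \<Union>(u n)"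
    then have "\<forall>n. (\<forall>U\<in>(\<inter>) Y ` u n. openin (top_of_set Y) U) \<and> topspace (top_of_set Y) \<subseteq> \<Union>((\<inter>) Y ` u n)"
      by auto
    from M[unfolded menger_def, THEN spec, THEN mp, OF this]
    obtain v where v: "\<And>n. finite (v n)" "\<And>n. v n \<subseteq> (\<inter>) Y ` u n" "Y \<subseteq> (\<Union>n. \<Union>(v n))"
      by auto
    then have "\<exists>w. \<forall>n. w n \<subseteq> u n \<and> finite (w n) \<and> v n = (\<inter>) Y ` w n"
      by (intro choice) (metis finite_subset_image)
    then obtain w where w: "\<And>n. w n \<subseteq> u n \<and> finite (w n) \<and> v n = (\<inter>) Y ` w n"
      by blast
    have "Y \<subseteq> (\<Union>n. \<Union>(w n))"
    proof
      fix y assume "y \<in> Y"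
      then obtain n V where "V \<in> v n" "y \<in> V" using v(3) by blast
      then show "y \<in> (\<Union>n. \<Union>(w n))" using w[of n] by auto
    qed
    then show "\<exists>v. (\<forall>n. finite (v n) \<and> v n \<subseteq> u n) \<and> Y \<subseteq> (\<Union>n. \<Union>(v n))"
      using w by (intro exI[of _ w] conjI allI) simp_all
  qed
next
  assume R: ?rhs
  show "menger (top_of_set Y)"
    unfolding menger_def
  proof (intro allI impI)
    fix u :: "nat \<Rightarrow> 'a set set"
    assume u: "\<forall>n. (\<forall>U\<in>u n. openin (top_of_set Y) U) \<and> topspace (top_of_set Y) \<subseteq> \<Union>(u n)"
    define u' where "u' n = {U. open U \<and> Y \<inter> U \<in> u n}" for n
    have "Y \<subseteq> \<Union>(u' n)" for n
    proof
      fix y assume "y \<in> Y"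
      then obtain V where V: "V \<in> u n" "y \<in> V" using u by fastforce
      then have "openin (top_of_set Y) V" using u by blast
      then obtain U where "open U" "V = Y \<inter> U" unfolding openin_open by blast
      then show "y \<in> \<Union>(u' n)" using V by (auto simp: u'_def)
    qed
    then have "\<forall>n. (\<forall>U\<in>u' n. open U) \<and> Y \<subseteq> \<Union>(u' n)"
      by (auto simp: u'_def)
    from R[THEN spec, THEN mp, OF this]
    obtain v where v: "\<And>n. finite (v n)" "\<And>n. v n \<subseteq> u' n" "Y \<subseteq> (\<Union>n. \<Union>(v n))"
      by blast
    have "topspace (top_of_set Y) \<subseteq> (\<Union>n. \<Union>((\<inter>) Y ` v n))"
      using v(3) by auto
    then show "\<exists>v. (\<forall>n. finite (v n) \<and> v n \<subseteq> u n) \<and> topspace (top_of_set Y) \<subseteq> (\<Union>n. \<Union>(v n))"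
      using v by (intro exI[of _ "\<lambda>n. (\<inter>) Y ` v n"]) (auto simp: u'_def)
  qed
qed

text \<open>The Menger property is applied to every tail of the sequence of covers; stage
  \<open>n\<close> collects the choices made for the finitely many tails starting at some N \<le> n.
  Covering infinitely often survives the finitely many exceptions in \<open>le_star\<close>.\<close>

lemma menger_cover_infinitely_often:
  fixes Y :: "'a::topological_space set"
  assumes M: "menger (top_of_set Y)"
    and u: "\<And>n U. U \<in> u n \<Longrightarrow> open U" "\<And>n. Y \<subseteq> \<Union>(u n)"
  obtains v where "\<And>n::nat. finite (v n)" "\<And>n. v n \<subseteq> u n"
    "\<And>y. y \<in> Y \<Longrightarrow> \<exists>\<^sub>\<infinity>n. y \<in> \<Union>(v n)"
proof -
  have "\<exists>v. (\<forall>n::nat. finite (v n) \<and> v n \<subseteq> u (n + N)) \<and> Y \<subseteq> (\<Union>n. \<Union>(v n))" for N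
    using u by (intro M[unfolded menger_top_of_set, THEN spec, THEN mp] allI conjI ballI)
  then obtain v where v: "\<And>N n::nat. finite (v N n)" "\<And>N n. v N n \<subseteq> u (n + N)"
      "\<And>N. Y \<subseteq> (\<Union>n. \<Union>(v N n))"
    by metis
  define w where "w n = (\<Union>N\<le>n. v N (n - N))" for n
  show thesis
  proof
    show "finite (w n)" for n by (simp add: w_def v)
    show "w n \<subseteq> u n" for n
      using v(2) by (fastforce simp: w_def)
    show "\<exists>\<^sub>\<infinity>n. y \<in> \<Union>(w n)" if "y \<in> Y" for y
      unfolding INFM_nat_le
    proof
      fix N
      from \<open>y \<in> Y\<close> v(3)[of N] have "y \<in> (\<Union>n. \<Union>(v N n))" by (rule rev_subsetD)
      then obtain n where "y \<in> \<Union>(v N n)" by (rule UN_E)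
      moreover have "v N n \<subseteq> w (n + N)"
        using UN_upper[of N "{..n + N}" "\<lambda>k. v k (n + N - k)"] by (simp add: w_def)
      ultimately have "y \<in> \<Union>(w (n + N))" using Union_mono by blast
      then show "\<exists>n\<ge>N. y \<in> \<Union>(w n)" by (metis le_add2)
    qed
  qed
qed

text \<open>This amounts to |K| < b. Quantifying over functions on \<open>K\<close> treats finite
  index sets and sets smaller than b alike, without naming a cardinal.\<close>

definition star_bounding :: "'i set \<Rightarrow> bool" where
  "star_bounding K \<longleftrightarrow> (\<forall>f. \<exists>x. \<forall>i\<in>K. le_star (f i) x)"

lemma star_bounding_finite:
  assumes "finite K" shows "star_bounding K"
  unfolding star_bounding_def
proof
  fix f :: "'a \<Rightarrow> nat \<Rightarrow> nat"
  have "f i n \<le> (\<Sum>i\<in>K. f i n)" if "i \<in> K" for i n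
    using assms that by (intro member_le_sum) auto
  then show "\<exists>x. \<forall>i\<in>K. le_star (f i) x"
    by (intro exI[of _ "\<lambda>n. \<Sum>i\<in>K. f i n"]) (auto simp: le_star_def)
qed

text \<open>After enumerating countable subcovers, the finite choices for \<open>Y i\<close> are
  bounded by a function \<open>k i\<close>. A common bound \<open>x\<close> suffices: a point is
  caught below \<open>k i n\<close> for infinitely many n, and k i n \<le> x n for all but finitely
  many.\<close>

lemma menger_Union_star_bounding:
  fixes Y :: "'i \<Rightarrow> 'a::second_countable_topology set"
  assumes K: "star_bounding K" and Y: "\<And>i. i \<in> K \<Longrightarrow> menger (top_of_set (Y i))"
  shows "menger (top_of_set (\<Union>i\<in>K. Y i))"
  unfolding menger_top_of_set
proof (intro allI impI)
  fix u :: "nat \<Rightarrow> 'a set set"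
  assume u: "\<forall>n. (\<forall>U\<in>u n. open U) \<and> (\<Union>i\<in>K. Y i) \<subseteq> \<Union>(u n)"
  show "\<exists>v. (\<forall>n. finite (v n) \<and> v n \<subseteq> u n) \<and> (\<Union>i\<in>K. Y i) \<subseteq> (\<Union>n. \<Union>(v n))"
  \<comment> \<open>A nonempty union forces each countable subcover to be nonempty, as its
    enumeration by \<open>from_nat_into\<close> requires.\<close>
  proof (cases "(\<Union>i\<in>K. Y i) = {}")
    case True
    then show ?thesis by (intro exI[of _ "\<lambda>_. {}"]) auto
  next
    case False
    have "\<exists>C. C \<subseteq> u n \<and> countable C \<and> \<Union>C = \<Union>(u n)" for n
      using Lindelof[of "u n"] u by metis
    then have "\<forall>n. \<exists>C. C \<subseteq> u n \<and> countable C \<and> \<Union>C = \<Union>(u n)" ..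
    then obtain C where "\<forall>n. C n \<subseteq> u n \<and> countable (C n) \<and> \<Union>(C n) = \<Union>(u n)"
      unfolding choice_iff ..
    then have C: "C n \<subseteq> u n" "countable (C n)" "\<Union>(C n) = \<Union>(u n)" for n
      by simp_all
    have ne: "C n \<noteq> {}" for n
    proof
      assume "C n = {}"
      then have "\<Union>(u n) = {}" unfolding C(3)[of n, symmetric] by simp
      moreover have "(\<Union>i\<in>K. Y i) \<subseteq> \<Union>(u n)" using u by simp
      ultimately show False using False by (simp only: subset_empty)
    qed
    define e where "e n = from_nat_into (C n)" for n
    have range_e: "range (e n) = C n" for n
      using C ne by (simp add: e_def)
    have "\<exists>k. \<forall>y\<in>Y i. \<exists>\<^sub>\<infinity>n. y \<in> \<Union>(e n ` {..<k n})" if "i \<in> K" for i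
    proof -
      have C_open: "U \<in> C n \<Longrightarrow> open U" for n U
        using u C(1) by blast
      have C_cover: "Y i \<subseteq> \<Union>(C n)" for n
        unfolding C(3) using u that by blast
      obtain v where v: "\<And>n. finite (v n)" "\<And>n. v n \<subseteq> C n"
        "\<And>y. y \<in> Y i \<Longrightarrow> \<exists>\<^sub>\<infinity>n. y \<in> \<Union>(v n)"
        by (rule menger_cover_infinitely_often[where u = C, OF Y[OF \<open>i \<in> K\<close>] C_open C_cover])
          (assumption, rule that)
      have "\<exists>k. v n \<subseteq> e n ` {..<k}" for n
      proof -
        have "v n \<subseteq> e n ` UNIV" using v(2) range_e by simp
        from finite_subset_image[OF v(1) this]
        obtain J where J: "finite J" "v n = e n ` J" by blast
        then obtain k where "J \<subseteq> {..<k}" by (meson finite_nat_iff_bounded)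
        then show ?thesis unfolding J(2) by (intro exI[of _ k] image_mono)
      qed
      then obtain k where k: "\<And>n. v n \<subseteq> e n ` {..<k n}" by metis
      have "\<exists>\<^sub>\<infinity>n. y \<in> \<Union>(e n ` {..<k n})" if "y \<in> Y i" for y
        using v(3)[OF that] by (rule INFM_mono) (use k in blast)
      then show ?thesis by blast
    qed
    then have "\<exists>k. \<forall>i\<in>K. \<forall>y\<in>Y i. \<exists>\<^sub>\<infinity>n. y \<in> \<Union>(e n ` {..<k i n})"
      by (intro bchoice ballI)
    then obtain k where k: "\<And>i y. i \<in> K \<Longrightarrow> y \<in> Y i \<Longrightarrow> \<exists>\<^sub>\<infinity>n. y \<in> \<Union>(e n ` {..<k i n})"
      by blast
    obtain x where x: "\<And>i. i \<in> K \<Longrightarrow> le_star (k i) x"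
      using K unfolding star_bounding_def by metis
    have "\<exists>n. y \<in> \<Union>(e n ` {..<x n})" if "i \<in> K" "y \<in> Y i" for i y
    proof -
      have "\<exists>\<^sub>\<infinity>n. y \<in> \<Union>(e n ` {..<k i n})" "\<forall>\<^sub>\<infinity>n. k i n \<le> x n"
        using k[OF that] x[OF that(1)] by (simp_all add: le_star_def cofinite_eq_sequentially)
      from INFM_EX[OF INFM_conjI[OF this]]
      obtain n where n: "y \<in> \<Union>(e n ` {..<k i n})" "k i n \<le> x n" by blast
      from n(2) have "e n ` {..<k i n} \<subseteq> e n ` {..<x n}" by (intro image_mono) simp
      with n(1) show ?thesis by blast
    qed
    then have "(\<Union>i\<in>K. Y i) \<subseteq> (\<Union>n. \<Union>(e n ` {..<x n}))"
      unfolding subset_iff UN_iff by blast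
    moreover have "finite (e n ` {..<x n}) \<and> e n ` {..<x n} \<subseteq> u n" for n
      using image_mono[of "{..<x n}" UNIV "e n"] range_e[of n] C(1)[of n] by simp
    ultimately show ?thesis
      by (intro exI[of _ "\<lambda>n. e n ` {..<x n}"] conjI allI) simp_all
  qed
qed

section \<open>Finite powers of a family enlarged by the eventually constant sequences\<close>

section \<open>Finite powers\<close>

lemma open_fun_contains_cylinder:
  fixes t :: "nat \<Rightarrow> 'a::topological_space"
  assumes "open U" "t \<in> U"
  obtains m V where "\<And>i. open (V i)" "\<And>i. t i \<in> V i" "\<And>y. (\<And>i. i < m \<Longrightarrow> y i \<in> V i) \<Longrightarrow> y \<in> U"
proof -
  obtain V where V: "t \<in> (\<Pi>\<^sub>E i\<in>UNIV. V i)" "\<And>i. open (V i)" "finite {i. V i \<noteq> UNIV}"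
      "(\<Pi>\<^sub>E i\<in>UNIV. V i) \<subseteq> U"
    using product_topology_open_contains_basis[of "\<lambda>_. euclidean" UNIV U t] assms
    by (auto simp: euclidean_product_topology)
  obtain m where m: "{i. V i \<noteq> UNIV} \<subseteq> {..<m}"
    using V(3) finite_nat_iff_bounded by blast
  show thesis
  proof
    fix y assume y: "\<And>i. i < m \<Longrightarrow> y i \<in> V i"
    have "y i \<in> V i" for i
      using y[of i] m by (cases "V i = UNIV") auto
    then show "y \<in> U" using V(4) by (auto simp: PiE_iff)
  qed (use V in auto)
qed

text \<open>A basic neighbourhood restricts finitely many rows, each in finitely many columns; the
  sum of these column bounds serves all rows.\<close>

lemma open_matrix_contains_cylinder:
  fixes t :: "nat \<Rightarrow> nat \<Rightarrow> 'a::topological_space"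
  assumes "open U" "t \<in> U"
  obtains m where "\<And>y. (\<And>i j. j < m \<Longrightarrow> y i j = t i j) \<Longrightarrow> y \<in> U"
proof -
  obtain M V where V: "\<And>i. open (V i)" "\<And>i. t i \<in> V i"
      and M: "\<And>y. (\<And>i. i < M \<Longrightarrow> y i \<in> V i) \<Longrightarrow> y \<in> U"
    using open_fun_contains_cylinder[OF assms] by metis
  have "\<exists>m. \<forall>y. (\<forall>j<m. y j = t i j) \<longrightarrow> y \<in> V i" for i
    using open_fun_contains_cylinder[OF V(1,2)] by metis
  then obtain m where m: "\<And>i y. (\<And>j. j < m i \<Longrightarrow> y j = t i j) \<Longrightarrow> y \<in> V i"
    by metis
  show thesis
  proof
    fix y assume y: "\<And>i j. j < (\<Sum>i<M. m i) \<Longrightarrow> y i j = t i j"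
    show "y \<in> U"
    proof (rule M, rule m)
      fix i j assume "i < M" "j < m i"
      moreover have "m i \<le> (\<Sum>i<M. m i)" using \<open>i < M\<close> by (intro member_le_sum) auto
      ultimately show "y i j = t i j" by (intro y) simp
    qed
  qed
qed

text \<open>Half of the covers handle the points whose rows are all \<open>c\<close> on [n, g n) for
  some n. The remaining points have a row \<open>s d\<close> with \<open>d\<close> in the small set
  \<open>K\<close>, so they lie in a small union of copies of lower powers, which are Menger by
  induction. The filter \<open>F\<close> provides one n for all rows at once.\<close>

lemma menger_finite_power:
  fixes s :: "'i \<Rightarrow> nat \<Rightarrow> bool" and c :: bool
  assumes F: "F \<noteq> bot" "F \<le> sequentially"
    and small: "\<And>g. \<exists>K\<subseteq>D. star_bounding K \<and>
        (\<forall>d\<in>D - K. \<forall>\<^sub>F n in F. \<forall>j\<in>{n..<g n}. s d j = c)"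
    and X: "X = s ` D \<union> {x. \<forall>\<^sub>F j in sequentially. x j = c}"
    and "finite (I :: nat set)"
  shows "menger (top_of_set (\<Pi>\<^sub>E i\<in>I. X))"
  using \<open>finite I\<close>
proof (induction I rule: finite_psubset_induct)
  case (psubset I)
  show ?case
    unfolding menger_top_of_set
  proof (intro allI impI)
    fix u :: "nat \<Rightarrow> (nat \<Rightarrow> nat \<Rightarrow> bool) set set"
    let ?P = "\<Pi>\<^sub>E i\<in>I. X"
    assume u: "\<forall>n. (\<forall>U\<in>u n. open U) \<and> ?P \<subseteq> \<Union>(u n)"
    \<comment> \<open>These finitely many matrices belong to the power because \<open>X\<close>
      contains every sequence that is eventually \<open>c\<close>.\<close>
    define T where "T n = (\<Pi>\<^sub>E i\<in>I. {x. \<forall>j\<ge>n. x j = c})" for n :: nat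
    have "finite {x. \<forall>j\<ge>n. x j = c}" for n :: nat
    proof (rule finite_subset)
      show "{x. \<forall>j\<ge>n. x j = c} \<subseteq> (\<lambda>A j. if j < n then j \<in> A else c) ` Pow {..<n}"
      proof
        fix x assume "x \<in> {x. \<forall>j\<ge>n. x j = c}"
        then show "x \<in> (\<lambda>A j. if j < n then j \<in> A else c) ` Pow {..<n}"
          by (intro image_eqI[of _ _ "{j. j < n \<and> x j}"]) (auto simp: fun_eq_iff not_less)
      qed
    qed simp
    then have finT: "finite (T n)" for n
      using psubset.hyps by (auto simp: T_def intro!: finite_PiE)
    have T_sub: "T n \<subseteq> ?P" for n
      by (auto simp: T_def X PiE_iff eventually_sequentially)
    have "\<exists>U m. U \<in> u (2 * n) \<and> (\<forall>y. (\<forall>i. \<forall>j<m. y i j = t i j) \<longrightarrow> y \<in> U)" if t: "t \<in> T n" for n t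
    proof -
      obtain U where "U \<in> u (2 * n)" "t \<in> U" using u T_sub t by blast
      moreover from this u have "open U" by blast
      ultimately show ?thesis using open_matrix_contains_cylinder[of U t] by metis
    qed
    then have "\<forall>n t. \<exists>U m. t \<in> T n \<longrightarrow> U \<in> u (2 * n) \<and> (\<forall>y. (\<forall>i. \<forall>j<m. y i j = t i j) \<longrightarrow> y \<in> U)"
      by blast
    then obtain U m where Um: "\<forall>n t. t \<in> T n \<longrightarrow>
        U n t \<in> u (2 * n) \<and> (\<forall>y. (\<forall>i. \<forall>j<m n t. y i j = t i j) \<longrightarrow> y \<in> U n t)"
      unfolding choice_iff by blast
    then have Uu: "\<And>n t. t \<in> T n \<Longrightarrow> U n t \<in> u (2 * n)"
      and U: "\<And>n t y. t \<in> T n \<Longrightarrow> (\<And>i j. j < m n t \<Longrightarrow> y i j = t i j) \<Longrightarrow> y \<in> U n t"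
      by blast+
    \<comment> \<open>The sum bounds all cylinder lengths for \<open>T n\<close>: a point whose rows
      are \<open>c\<close> on [n, g n) agrees, in every column that matters, with its truncation in
      \<open>T n\<close>.\<close>
    define g where "g n = (\<Sum>t\<in>T n. m n t)" for n
    obtain K where K: "K \<subseteq> D" "star_bounding K"
      "\<And>d. d \<in> D \<Longrightarrow> d \<notin> K \<Longrightarrow> \<forall>\<^sub>F n in F. \<forall>j\<in>{n..<g n}. s d j = c"
      using small[of g] by blast
    define Z where "Z i d = (\<lambda>y. y(i := s d)) ` (\<Pi>\<^sub>E i\<in>I - {i}. X)" for i d
    have "menger (top_of_set (Z i d))" if "i \<in> I" for i d
    proof (rule menger_continuous_map_image)
      show "menger (top_of_set (\<Pi>\<^sub>E i\<in>I - {i}. X))"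
        using that by (intro psubset.IH) auto
      have "continuous_on (\<Pi>\<^sub>E i\<in>I - {i}. X) (\<lambda>y. y(i := s d))"
      proof (rule continuous_on_coordinatewise_then_product)
        fix k show "continuous_on (\<Pi>\<^sub>E i\<in>I - {i}. X) (\<lambda>y. (y(i := s d)) k)"
          by (cases "k = i") (auto intro: continuous_on_subset[OF continuous_on_product_coordinates])
      qed
      then show "continuous_map (top_of_set (\<Pi>\<^sub>E i\<in>I - {i}. X)) (top_of_set (Z i d)) (\<lambda>y. y(i := s d))"
        by (auto simp: Z_def continuous_map_in_subtopology)
    qed (simp add: Z_def)
    then have "menger (top_of_set (\<Union>i\<in>I. \<Union>d\<in>K. Z i d))"
      using K(2) star_bounding_finite[OF psubset.hyps]
      by (intro menger_Union_star_bounding)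
    note bad = this[unfolded menger_top_of_set, THEN spec, of "\<lambda>n. u (2 * n + 1)", THEN mp]
    have "s d \<in> X" if "d \<in> K" for d using that K(1) X by auto
    then have "(\<Union>i\<in>I. \<Union>d\<in>K. Z i d) \<subseteq> ?P"
      by (fastforce simp: Z_def PiE_iff extensional_def)
    then have "\<forall>n. (\<forall>U\<in>u (2 * n + 1). open U) \<and> (\<Union>i\<in>I. \<Union>d\<in>K. Z i d) \<subseteq> \<Union>(u (2 * n + 1))"
      using u by (meson order_trans)
    from bad[OF this] obtain w where w: "\<And>n. finite (w n)" "\<And>n. w n \<subseteq> u (2 * n + 1)"
        "(\<Union>i\<in>I. \<Union>d\<in>K. Z i d) \<subseteq> (\<Union>n. \<Union>(w n))"
      by blast
    \<comment> \<open>Even covers serve the matrices in \<open>T n\<close>, odd covers the pieces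
      \<open>Z i d\<close>.\<close>
    define v where "v n = (if even n then U (n div 2) ` T (n div 2) else w (n div 2))" for n
    have "finite (v n) \<and> v n \<subseteq> u n" for n
    proof (cases "even n")
      case True
      then show ?thesis using finT Uu[of _ "n div 2"] by (auto simp: v_def)
    next
      case False
      then show ?thesis using w(1,2)[of "n div 2"] by (simp add: v_def)
    qed
    moreover have "y \<in> (\<Union>n. \<Union>(v n))" if y: "y \<in> ?P" for y
    proof (cases "\<exists>i\<in>I. \<exists>d\<in>K. y i = s d")
      case True
      then obtain i d where id: "i \<in> I" "d \<in> K" "y i = s d" by blast
      \<comment> \<open>The preimage is \<open>y\<close> with row \<open>i\<close> reset to
        \<open>undefined\<close>, the value required outside \<open>I - {i}\<close>.\<close>
      have "y \<in> Z i d"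
        using y id by (auto simp: Z_def PiE_iff extensional_def split: if_splits
            intro!: image_eqI[of _ _ "y(i := undefined)"])
      then obtain n where "y \<in> \<Union>(w n)" using w(3) id by blast
      then have "y \<in> \<Union>(v (2 * n + 1))" by (simp add: v_def)
      then show ?thesis by blast
    next
      case False
      have "\<forall>\<^sub>F n in F. \<forall>j\<in>{n..<g n}. y i j = c" if i: "i \<in> I" for i
      proof -
        consider d where "d \<in> D" "y i = s d" | "\<forall>\<^sub>F j in sequentially. y i j = c"
          using y i by (auto simp: X PiE_iff)
        then show ?thesis
        proof cases
          case 1
          then show ?thesis using K(3)[of d] False i by auto
        next
          case 2
          then have "\<forall>\<^sub>F n in sequentially. \<forall>j\<in>{n..<g n}. y i j = c"
            by (rule eventually_mono[OF eventually_all_ge_at_top]) auto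
          then show ?thesis using F(2) by (rule filter_leD[rotated])
        qed
      qed
      \<comment> \<open>Finitely many rows give a single eventual condition, and properness of
        \<open>F\<close> then yields an n.\<close>
      then have "\<forall>\<^sub>F n in F. \<forall>i\<in>I. \<forall>j\<in>{n..<g n}. y i j = c"
        using psubset.hyps by (intro eventually_ball_finite) auto
      from eventually_happens'[OF F(1) this]
      obtain n where "\<forall>i\<in>I. \<forall>j\<in>{n..<g n}. y i j = c" ..
      then have n: "\<And>i j. i \<in> I \<Longrightarrow> n \<le> j \<Longrightarrow> j < g n \<Longrightarrow> y i j = c"
        by simp
      \<comment> \<open>The truncation of \<open>y\<close> at column n, continued by
        \<open>c\<close>; \<open>undefined\<close> outside \<open>I\<close> keeps it in the
        extensional product.\<close>
      define t where "t i = (if i \<in> I then \<lambda>j. if j < n then y i j else c else undefined)" for i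
      have t: "t \<in> T n" by (auto simp: T_def t_def)
      have "m n t \<le> g n"
        unfolding g_def using t finT by (intro member_le_sum) auto
      then have "y \<in> U n t"
        using n y by (intro U[OF t]) (auto simp: t_def PiE_iff extensional_def)
      then have "y \<in> \<Union>(v (2 * n))" using t by (auto simp: v_def)
      then show ?thesis by blast
    qed
    then have "?P \<subseteq> (\<Union>n. \<Union>(v n))" by (rule subsetI)
    ultimately show "\<exists>v. (\<forall>n. finite (v n) \<and> v n \<subseteq> u n) \<and> ?P \<subseteq> (\<Union>n. \<Union>(v n))"
      by (intro exI[of _ v] conjI allI) simp_all
  qed
qed

lemma menger_product_cantor:
  assumes "menger (top_of_set (\<Pi>\<^sub>E i\<in>I. X))"
  shows "menger (product_topology (\<lambda>_. subtopology cantor_space X) I)"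
proof (rule menger_continuous_map_image[OF assms])
  have "continuous_on (\<Pi>\<^sub>E i\<in>I. X) (\<lambda>y. y k)" for k
    by (auto intro: continuous_on_subset[OF continuous_on_product_coordinates])
  then show "continuous_map (top_of_set (\<Pi>\<^sub>E i\<in>I. X))
      (product_topology (\<lambda>_. subtopology cantor_space X) I) (\<lambda>y. y)"
    by (auto simp: continuous_map_componentwise cantor_space_eq_euclidean
        continuous_map_in_subtopology PiE_iff)
qed (simp add: cantor_space_eq_euclidean)

section \<open>Interval partitions coloured alternately, and their long constant stretches\<close>

section \<open>Alternating interval partitions\<close>

text \<open>Block boundaries. Applying \<open>h\<close> twice leaves room: if m lies between a knot
  a and h a, then [m, h m) stays inside the block, for monotone \<open>h\<close>.\<close>

definition knots :: "(nat \<Rightarrow> nat) \<Rightarrow> nat \<Rightarrow> nat" where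
  "knots h k = ((\<lambda>n. h (h n)) ^^ k) 0"

text \<open>The characteristic function of the blocks of odd index; the least k picks the block
  containing \<open>i\<close>.\<close>

definition stripes :: "(nat \<Rightarrow> nat) \<Rightarrow> nat \<Rightarrow> bool" where
  "stripes h i \<longleftrightarrow> odd (LEAST k. i < knots h (Suc k))"

text \<open>For fixed \<open>c\<close>, these sets and the cofinite ones will generate the filter
  used for the powers.\<close>

definition flat :: "(nat \<Rightarrow> nat) \<Rightarrow> bool \<Rightarrow> nat set" where
  "flat h c = {n. \<forall>i\<in>{n..<h n}. stripes h i = c}"

definition swift :: "(nat \<Rightarrow> nat) \<Rightarrow> bool" where
  "swift h \<longleftrightarrow> mono h \<and> (\<forall>n. n < h n)"

text \<open>For infinite \<open>M\<close>: \<open>h\<close> eventually dominates the function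
  sending n to the least element of \<open>M\<close> that is at least n.\<close>

definition hits :: "nat set \<Rightarrow> (nat \<Rightarrow> nat) \<Rightarrow> bool" where
  "hits M h \<longleftrightarrow> (\<forall>\<^sub>F n in sequentially. \<exists>m\<in>M. n \<le> m \<and> m \<le> h n)"

lemma knots_Suc: "knots h (Suc k) = h (h (knots h k))"
  by (simp add: knots_def)

lemma strict_mono_knots: "swift h \<Longrightarrow> strict_mono (knots h)"
  by (rule strict_monoI_Suc) (metis knots_Suc less_trans swift_def)

lemma stripes_index:
  assumes "swift h"
  obtains k where "knots h k \<le> i" "i < knots h (Suc k)" "stripes h i = odd k"
proof -
  let ?L = "LEAST k. i < knots h (Suc k)"
  have "i < knots h (Suc i)"
    using strict_mono_imp_increasing[OF strict_mono_knots[OF assms], of "Suc i"] by simp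
  then have L: "i < knots h (Suc ?L)" by (rule LeastI)
  have "knots h ?L \<le> i"
  proof (cases ?L)
    case 0
    then show ?thesis by (simp only: 0) (simp add: knots_def)
  next
    case (Suc k)
    then have "\<not> i < knots h (Suc k)" using not_less_Least[of k "\<lambda>k. i < knots h (Suc k)"] by simp
    then show ?thesis by (simp only: Suc not_less)
  qed
  with L show thesis using that by (auto simp: stripes_def)
qed

lemma stripes_eq:
  assumes "swift h" "knots h k \<le> i" "i < knots h (Suc k)"
  shows "stripes h i = odd k"
proof -
  obtain l where l: "knots h l \<le> i" "i < knots h (Suc l)" "stripes h i = odd l"
    using stripes_index[OF assms(1)] .
  have "knots h k < knots h (Suc l)" "knots h l < knots h (Suc k)" using assms l by linarith+
  then have "k = l"
    using strict_mono_less[OF strict_mono_knots[OF assms(1)]] by simp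
  then show ?thesis using l by simp
qed

text \<open>In a late block of the parity given by \<open>c\<close>, with left knot a, some m in
  \<open>M\<close> satisfies a \<le> m \<le> h a. By monotonicity h m \<le> h (h a), the next knot,
  so [m, h m) does not leave the block.\<close>

lemma infinite_Int_flat:
  assumes h: "swift h" and M: "hits M h"
  shows "infinite (M \<inter> flat h c)"
  unfolding infinite_nat_iff_unbounded_le
proof
  fix N
  obtain N' where N': "\<And>n. n \<ge> N' \<Longrightarrow> \<exists>m\<in>M. n \<le> m \<and> m \<le> h n"
    using M by (auto simp: hits_def eventually_sequentially)
  define k where "k = 2 * (N + N') + of_bool c"
  have k: "odd k = c" "k \<ge> N" "k \<ge> N'" by (auto simp: k_def)
  have le: "k \<le> knots h k"
    using strict_mono_imp_increasing[OF strict_mono_knots[OF h]] .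
  then obtain m where m: "m \<in> M" "knots h k \<le> m" "m \<le> h (knots h k)"
    using N'[of "knots h k"] k by auto
  then have "h m \<le> knots h (Suc k)"
    using h by (auto simp: knots_Suc swift_def monoD)
  then have "m \<in> flat h c"
    using stripes_eq[OF h, of k] m k by (auto simp: flat_def)
  then show "\<exists>m\<ge>N. m \<in> M \<inter> flat h c"
    using m k le by (intro exI[of _ m]) auto
qed

text \<open>Two changes put a whole block between \<open>i\<close> and \<open>k\<close>. If p is its
  left knot, then n < p, and its right knot h (h p) exceeds h p \<ge> h n.\<close>

lemma stripes_two_changes:
  assumes h: "swift h" and "n \<le> i" "i < j" "j < k"
    and ne: "stripes h i \<noteq> stripes h j" "stripes h j \<noteq> stripes h k"
  shows "h n < k"
proof -
  obtain a where a: "knots h a \<le> i" "i < knots h (Suc a)" "stripes h i = odd a"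
    using stripes_index[OF h] .
  obtain b where b: "knots h b \<le> j" "j < knots h (Suc b)" "stripes h j = odd b"
    using stripes_index[OF h] .
  obtain c where c: "knots h c \<le> k" "k < knots h (Suc c)" "stripes h k = odd c"
    using stripes_index[OF h] .
  note less = strict_mono_less[OF strict_mono_knots[OF h]]
  have "a < Suc b" "b < Suc c"
    using less[of a "Suc b"] less[of b "Suc c"] a b c assms(3,4) by linarith+
  moreover have "a \<noteq> b" "b \<noteq> c" using ne a b c by auto
  ultimately have "Suc (Suc a) \<le> c" by simp
  then have "knots h (Suc (Suc a)) \<le> knots h c"
    using strict_mono_less_eq[OF strict_mono_knots[OF h]] by blast
  moreover have "h n \<le> h (knots h (Suc a))"
    using h a assms(2) by (auto simp: swift_def intro: monoD)
  moreover have "h (knots h (Suc a)) < knots h (Suc (Suc a))"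
    using h by (simp add: knots_Suc swift_def)
  ultimately show ?thesis using c by linarith
qed

section \<open>Choosing \<open>h d\<close> along a well-order so that the sets
  \<open>flat (h d) c\<close> are centered\<close>

section \<open>Recursion along the dominating family\<close>

unbundle cardinal_syntax

text \<open>Subsets of size n + 1 arise by insertion from K x P n, and countably many sizes add
  nothing. Hence fewer than b finite intersections have to be met at each stage.\<close>

lemma card_of_Fpow_infinite:
  assumes "infinite K" shows "|Fpow K| \<le>o |K|"
proof -
  define P where "P n = {E. E \<subseteq> K \<and> finite E \<and> card E = n}" for n
  have "|P n| \<le>o |K|" for n
  proof (induction n)
    case 0
    have "P 0 = {{}}" by (auto simp: P_def)
    then show ?case using assms by (simp add: card_of_singl_ordLeq infinite_imp_nonempty)
  next
    case (Suc n)
    have "P (Suc n) \<subseteq> (\<lambda>(x, E). insert x E) ` (K \<times> P n)"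
    proof
      fix E assume "E \<in> P (Suc n)"
      then have "E \<subseteq> K" "card E = Suc n" by (auto simp: P_def)
      moreover from this obtain x E' where "E = insert x E'" "x \<notin> E'" "card E' = n"
          "n = 0 \<longrightarrow> E' = {}"
        by (auto simp: card_Suc_eq)
      moreover from this \<open>E \<in> P (Suc n)\<close> have "finite E'" by (auto simp: P_def)
      ultimately show "E \<in> (\<lambda>(x, E). insert x E) ` (K \<times> P n)"
        by (intro image_eqI[of _ _ "(x, E')"]) (auto simp: P_def)
    qed
    then have "|P (Suc n)| \<le>o |K \<times> P n|"
      by (meson card_of_image card_of_mono1 ordLeq_transitive)
    also have "|K \<times> P n| \<le>o |K|"
      using assms Suc card_of_mono1[OF subset_refl, of K] by (intro card_of_Sigma_ordLeq_infinite ballI)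
    finally show ?case .
  qed
  then have "|\<Union>n. P n| \<le>o |K|"
    using assms by (intro card_of_UNION_ordLeq_infinite) (auto simp: infinite_iff_card_of_nat)
  moreover have "Fpow K = (\<Union>n. P n)" by (auto simp: Fpow_def P_def)
  ultimately show ?thesis by simp
qed

lemma swift_majorant_exists:
  "\<exists>h. swift h \<and> (\<forall>n. x n \<le> h n)"
proof (intro exI conjI allI)
  let ?h = "\<lambda>n. Suc (n + (\<Sum>k\<le>n. x k))"
  show "swift ?h"
    by (auto simp: swift_def mono_iff_le_Suc)
  show "x n \<le> ?h n" for n
    using member_le_sum[of n "{..n}" x] by simp
qed

text \<open>Well-founded recursion whose indices are themselves functions. At stage \<open>d\<close>
  the earlier indices and the next-element functions of the finite intersections of earlier flat
  sets have common bounds, and \<open>h d\<close> is taken above these and above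
  \<open>d\<close>.\<close>

lemma swift_family_exists:
  fixes r :: "(nat \<Rightarrow> nat) rel"
  assumes r: "Well_order r"
    and small: "\<And>d. star_bounding (underS r d)" "\<And>d. star_bounding (Fpow (underS r d))"
  obtains h where "\<And>d. swift (h d)" "\<And>d d'. (d', d) \<in> r \<Longrightarrow> le_star d' (h d)"
    "\<And>d E c. E \<in> Fpow (underS r d) \<Longrightarrow> infinite (\<Inter>e\<in>E. flat (h e) c) \<Longrightarrow>
        hits (\<Inter>e\<in>E. flat (h e) c) (h d)"
proof -
  \<comment> \<open>Infinitude is a premise, so a suitable \<open>h\<close> exists for arbitrary
    earlier values \<open>f\<close> and the recursion carries no invariant;
    \<open>flat_centered\<close> discharges it afterwards.\<close>
  define good where "good f d h \<longleftrightarrow> swift h \<and> (\<forall>d'. (d', d) \<in> r \<longrightarrow> le_star d' h) \<and>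
      (\<forall>E\<in>Fpow (underS r d). \<forall>c. infinite (\<Inter>e\<in>E. flat (f e) c) \<longrightarrow> hits (\<Inter>e\<in>E. flat (f e) c) h)"
    for f d and h :: "nat \<Rightarrow> nat"
  have "\<exists>h. \<forall>d. good h d (h d)"
  proof (rule dependent_wf_choice)
    show "wf (r - Id)" using r by (simp add: well_order_on_def)
    show "good f d h = good g d h" if "\<And>z. (z, d) \<in> r - Id \<Longrightarrow> f z = g z" for f g d h
    proof -
      have "(\<Inter>e\<in>E. flat (f e) c) = (\<Inter>e\<in>E. flat (g e) c)" if "E \<in> Fpow (underS r d)" for E c
        using that \<open>\<And>z. (z, d) \<in> r - Id \<Longrightarrow> f z = g z\<close>
        by (intro INF_cong) (auto simp: Fpow_def underS_def)
      then show ?thesis by (simp add: good_def)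
    qed
    show "\<exists>h. good f d h" for f d
    proof -
      \<comment> \<open>The value is arbitrary when no such m exists; it is evaluated only for
        infinite intersections.\<close>
      define next_in where "next_in c E n = (LEAST m. n \<le> m \<and> m \<in> (\<Inter>e\<in>E. flat (f e) c))" for c E n
      obtain x where x: "\<forall>d'\<in>underS r d. le_star d' x"
        using small(1)[of d, unfolded star_bounding_def, THEN spec, of "\<lambda>d'. d'"] by blast
      have "\<exists>y. \<forall>E\<in>Fpow (underS r d). le_star (next_in c E) y" for c
        using small(2)[of d] unfolding star_bounding_def by blast
      then obtain y where y: "\<And>c E. E \<in> Fpow (underS r d) \<Longrightarrow> le_star (next_in c E) (y c)"
        by metis
      obtain h where h: "swift h" "\<And>n. d n + x n + y True n + y False n \<le> h n"
        using swift_majorant_exists[of "\<lambda>n. d n + x n + y True n + y False n"] by blast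
      have "d n \<le> h n" "x n \<le> h n" "y c n \<le> h n" for n c
        using h(2)[of n] by (cases c; simp)+
      note ge = this
      have "le_star d' h" if "(d', d) \<in> r" for d'
      proof (cases "d' = d")
        case True
        then show ?thesis using ge(1) by (simp add: le_star_def)
      next
        case False
        then have "le_star d' x" using x that by (auto simp: underS_def)
        then show ?thesis unfolding le_star_def
          by (rule eventually_mono) (use ge(2) le_trans in blast)
      qed
      moreover have "hits (\<Inter>e\<in>E. flat (f e) c) h"
        if E: "E \<in> Fpow (underS r d)" and inf: "infinite (\<Inter>e\<in>E. flat (f e) c)" for E c
        using y[OF E, of c] unfolding le_star_def hits_def
      proof (rule eventually_mono)
        fix n assume n: "next_in c E n \<le> y c n"
        have "\<exists>m. n \<le> m \<and> m \<in> (\<Inter>e\<in>E. flat (f e) c)"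
          using inf by (auto simp: infinite_nat_iff_unbounded_le)
        then have "n \<le> next_in c E n \<and> next_in c E n \<in> (\<Inter>e\<in>E. flat (f e) c)"
          unfolding next_in_def by (rule LeastI_ex)
        with n ge(3)[where n = n and c = c] show "\<exists>m\<in>\<Inter>e\<in>E. flat (f e) c. n \<le> m \<and> m \<le> h n"
          by (meson le_trans)
      qed
      ultimately show ?thesis using h(1) unfolding good_def by blast
    qed
  qed
  then obtain h where h: "\<And>d. good h d (h d)" by blast
  show thesis
    by (rule that[of h]) (use h in \<open>simp_all add: good_def\<close>)
qed

text \<open>Remove the \<open>r\<close>-largest element \<open>d\<close> of \<open>E\<close>. The
  remaining intersection is infinite by induction, hence hit by \<open>h d\<close>, and so meets
  \<open>flat (h d) c\<close> infinitely often.\<close>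

lemma flat_centered:
  fixes r :: "'i rel" and h :: "'i \<Rightarrow> nat \<Rightarrow> nat"
  assumes r: "Well_order r" and h: "\<And>d. swift (h d)"
    "\<And>d E c. E \<in> Fpow (underS r d) \<Longrightarrow> infinite (\<Inter>e\<in>E. flat (h e) c) \<Longrightarrow>
        hits (\<Inter>e\<in>E. flat (h e) c) (h d)"
    and "finite E" "E \<subseteq> Field r"
  shows "infinite (\<Inter>e\<in>E. flat (h e) c)"
  using \<open>finite E\<close> \<open>E \<subseteq> Field r\<close>
proof (induction E rule: finite_psubset_induct)
  case (psubset E)
  show ?case
  proof (cases "E = {}")
    case False
    have "\<exists>d\<in>E. \<forall>e\<in>E. (e, d) \<in> r"
      using psubset.hyps False psubset.prems
    proof (induction rule: finite_ne_induct)
      case (singleton x)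
      then show ?case using r by (auto simp: order_on_defs refl_on_def)
    next
      case (insert x E)
      then obtain d where d: "d \<in> E" "\<forall>e\<in>E. (e, d) \<in> r" by auto
      have xx: "(x, x) \<in> r" and tot: "(x, d) \<in> r \<or> (d, x) \<in> r" and tr: "trans r"
        using r insert.prems d(1) by (cases "x = d"; auto simp: order_on_defs refl_on_def total_on_def)+
      from tot show ?case
      proof
        assume "(x, d) \<in> r" then show ?thesis using d by auto
      next
        assume "(d, x) \<in> r" then show ?thesis using d tr xx by (auto dest: transD)
      qed
    qed
    then obtain d where d: "d \<in> E" "\<forall>e\<in>E. (e, d) \<in> r" by blast
    have "infinite (\<Inter>e\<in>E - {d}. flat (h e) c)"
      using d psubset.prems by (intro psubset.IH) auto
    then have "hits (\<Inter>e\<in>E - {d}. flat (h e) c) (h d)"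
      using d psubset.hyps by (intro h(2)) (auto simp: Fpow_def underS_def)
    then have "infinite ((\<Inter>e\<in>E - {d}. flat (h e) c) \<inter> flat (h d) c)"
      by (rule infinite_Int_flat[OF h(1)])
    moreover have "(\<Inter>e\<in>E - {d}. flat (h e) c) \<inter> flat (h d) c = (\<Inter>e\<in>E. flat (h e) c)"
      using d(1) by auto
    ultimately show ?thesis by simp
  qed simp
qed

section \<open>The diagonal as a closed non-Menger subspace, and the two spaces\<close>

section \<open>The product\<close>

lemma menger_Int_closed:
  fixes Y :: "'a::topological_space set"
  assumes "menger (top_of_set Y)" "closed C"
  shows "menger (top_of_set (Y \<inter> C))"
  unfolding menger_top_of_set
proof (intro allI impI)
  fix u :: "nat \<Rightarrow> 'a set set"
  assume u: "\<forall>n. (\<forall>U\<in>u n. open U) \<and> Y \<inter> C \<subseteq> \<Union>(u n)"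
  have "\<forall>n. (\<forall>U\<in>insert (- C) (u n). open U) \<and> Y \<subseteq> \<Union>(insert (- C) (u n))"
    using u assms(2) by auto
  from assms(1)[unfolded menger_top_of_set, THEN spec, of "\<lambda>n. insert (- C) (u n)", THEN mp, OF this]
  obtain v where v: "\<forall>n. finite (v n) \<and> v n \<subseteq> insert (- C) (u n)" "Y \<subseteq> (\<Union>n. \<Union>(v n))"
    by (elim exE conjE)
  have "Y \<inter> C \<subseteq> (\<Union>n. \<Union>(v n - {- C}))"
  proof
    fix y assume y: "y \<in> Y \<inter> C"
    then obtain n V where "V \<in> v n" "y \<in> V" using v(2) by blast
    with y show "y \<in> (\<Union>n. \<Union>(v n - {- C}))" by blast
  qed
  moreover have "finite (v n - {- C}) \<and> v n - {- C} \<subseteq> u n" for n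
    using v(1) by auto
  ultimately show "\<exists>v. (\<forall>n. finite (v n) \<and> v n \<subseteq> u n) \<and> Y \<inter> C \<subseteq> (\<Union>n. \<Union>(v n))"
    by (intro exI[of _ "\<lambda>n. v n - {- C}"] conjI allI) simp_all
qed

lemma closed_diagonal_fun:
  "closed {p :: ('a \<Rightarrow> 'b::t2_space) \<times> ('a \<Rightarrow> 'b). fst p = snd p}"
proof -
  have "continuous_on UNIV (\<lambda>p :: ('a \<Rightarrow> 'b) \<times> ('a \<Rightarrow> 'b). fst p i)"
    "continuous_on UNIV (\<lambda>p :: ('a \<Rightarrow> 'b) \<times> ('a \<Rightarrow> 'b). snd p i)" for i
    by (rule continuous_on_product_then_coordinatewise[OF continuous_on_fst[OF continuous_on_id]]
        continuous_on_product_then_coordinatewise[OF continuous_on_snd[OF continuous_on_id]])+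
  then have "closed {p :: ('a \<Rightarrow> 'b) \<times> ('a \<Rightarrow> 'b). \<forall>i. fst p i = snd p i}"
    by (intro closed_Collect_all closed_Collect_eq)
  then show ?thesis by (simp add: fun_eq_iff)
qed

text \<open>The intersection is the projection of the diagonal part of the product, which is closed
  there.\<close>

lemma menger_Int_if_menger_prod:
  fixes X Y :: "('a \<Rightarrow> 'b::t2_space) set"
  assumes "menger (prod_topology (top_of_set X) (top_of_set Y))"
  shows "menger (top_of_set (X \<inter> Y))"
proof (rule menger_continuous_map_image)
  let ?D = "X \<times> Y \<inter> {p. fst p = snd p}"
  show "menger (top_of_set ?D)"
    using assms by (intro menger_Int_closed closed_diagonal_fun) simp
  show "continuous_map (top_of_set ?D) (top_of_set (X \<inter> Y)) fst"
    by (auto intro: continuous_on_fst)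
  show "topspace (top_of_set (X \<inter> Y)) \<subseteq> fst ` topspace (top_of_set ?D)"
    by force
qed

text \<open>A finite selection from the covers \<open>range (W n)\<close> would yield a function
  \<open>g\<close> such that every member changes twice in [n, g n) for infinitely many n. A member
  whose \<open>h\<close> eventually dominates \<open>g\<close> contradicts
  \<open>stripes_two_changes\<close>.\<close>

lemma not_menger_stripes:
  assumes H: "\<And>h. h \<in> H \<Longrightarrow> swift h" "dominating_family H"
  shows "\<not> menger (top_of_set (stripes ` H))"
proof
  assume M: "menger (top_of_set (stripes ` H))"
  define W where "W n m = {x :: nat \<Rightarrow> bool. \<exists>i j k. (n \<le> i \<and> i < j \<and> j < k \<and> k < m) \<and> x i \<noteq> x j \<and> x j \<noteq> x k}"
    for n m
  have W_open: "open (W n m)" for n m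
    unfolding W_def
    by (intro open_Collect_ex open_Collect_conj open_Collect_const open_Collect_neq
        continuous_on_product_coordinates)
  have W_mono: "W n m \<subseteq> W n m'" if "m \<le> m'" for n m m'
    unfolding W_def using that by fastforce
  have changes: "\<exists>j>i. stripes h j = c" if hH: "h \<in> H" for h i c
  proof -
    \<comment> \<open>All naturals are hit, so there are flat points of either colour arbitrarily
      far out, and j < h j makes j itself have that colour.\<close>
    have "hits UNIV h" using H(1)[OF hH]
      by (auto simp: hits_def swift_def intro!: always_eventually intro: less_imp_le)
    then obtain j where "j \<ge> Suc i" "j \<in> flat h c"
      using infinite_Int_flat[OF H(1)[OF hH], of UNIV c]
      by (auto simp: infinite_nat_iff_unbounded_le)
    then show ?thesis using H(1)[OF hH] by (intro exI[of _ j]) (auto simp: flat_def swift_def)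
  qed
  have "stripes h \<in> \<Union>(range (W n))" if h: "h \<in> H" for h n
  proof -
    obtain j where "j > n" "stripes h j = (\<not> stripes h n)" using changes[OF h] by blast
    moreover obtain k where "k > j" "stripes h k = stripes h n" using changes[OF h] by blast
    ultimately have "stripes h \<in> W n (Suc k)" unfolding W_def by blast
    then show ?thesis by blast
  qed
  then have cover: "stripes ` H \<subseteq> \<Union>(range (W n))" for n by blast
  have "open U" if "U \<in> range (W n)" for U n using that W_open by blast
  then obtain v where v: "\<And>n. finite (v n)" "\<And>n. v n \<subseteq> range (W n)"
      "\<And>y. y \<in> stripes ` H \<Longrightarrow> \<exists>\<^sub>\<infinity>n. y \<in> \<Union>(v n)"
    using menger_cover_infinitely_often[where u = "\<lambda>n. range (W n)", OF M _ cover] by metis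
  have "\<exists>m. \<Union>(v n) \<subseteq> W n m" for n
  proof -
    from finite_subset_image[OF v(1,2)[of n]]
    obtain J where J: "finite J" "v n = W n ` J" by (elim exE conjE)
    then obtain m where "\<And>j. j \<in> J \<Longrightarrow> j \<le> m" by (meson finite_nat_set_iff_bounded_le)
    then have "\<Union>(W n ` J) \<subseteq> W n m" using W_mono by (intro UN_least) simp
    then show ?thesis using J(2) by auto
  qed
  then obtain g where g: "\<And>n. \<Union>(v n) \<subseteq> W n (g n)" by metis
  obtain h where h: "h \<in> H" "le_star g h"
    using H(2) unfolding dominating_family_def by blast
  have "\<exists>\<^sub>\<infinity>n. stripes h \<in> \<Union>(v n)" "\<forall>\<^sub>\<infinity>n. g n \<le> h n"
    using v(3) h by (auto simp: le_star_def cofinite_eq_sequentially)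
  from INFM_EX[OF INFM_conjI[OF this]]
  obtain n where n: "stripes h \<in> \<Union>(v n)" "g n \<le> h n" by blast
  then obtain i j k where "n \<le> i" "i < j" "j < k" "k < g n"
    "stripes h i \<noteq> stripes h j" "stripes h j \<noteq> stripes h k"
    using g[of n] unfolding W_def by blast
  then show False
    using stripes_two_changes[OF H(1)[OF h(1)], of n i j k] n(2) by linarith
qed

lemma star_bounding_if_ordLess:
  assumes b: "\<And>A'. unbounded_family A' \<Longrightarrow> |A| \<le>o |A'|" and K: "|K| <o |A|"
  shows "star_bounding K"
  unfolding star_bounding_def
proof (rule allI, rule ccontr)
  fix f :: "'b \<Rightarrow> nat \<Rightarrow> nat"
  assume "\<nexists>x. \<forall>i\<in>K. le_star (f i) x"
  then have "unbounded_family (f ` K)" by (auto simp: unbounded_family_def)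
  from b[OF this] card_of_image have "|A| \<le>o |K|" by (rule ordLeq_transitive)
  with K show False using not_ordLess_ordLeq by blast
qed

theorem theorem5:
  assumes "b_eq_d"
  shows "\<exists>X0 X1 :: (nat \<Rightarrow> bool) set.
           (\<forall>n::nat. menger (product_topology (\<lambda>_. subtopology cantor_space X0) {..<n})) \<and>
           (\<forall>n::nat. menger (product_topology (\<lambda>_. subtopology cantor_space X1) {..<n})) \<and>
           \<not> menger (prod_topology (subtopology cantor_space X0) (subtopology cantor_space X1))"
proof -
  obtain A D :: "(nat \<Rightarrow> nat) set" where D: "dominating_family D" and A: "(card_of A, card_of D) \<in> ordIso"
    and b: "\<And>A'. unbounded_family A' \<Longrightarrow> |A| \<le>o |A'|"
    using assms unfolding b_eq_d_def by blast
  note bounding = star_bounding_if_ordLess[OF b ordLess_ordIso_trans[OF _ ordIso_symmetric[OF A]]]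
  \<comment> \<open>As a cardinal, \<open>|D|\<close> is a well-order of \<open>D\<close> of least
    type: all its proper initial segments are smaller than \<open>D\<close>, hence smaller than
    b.\<close>
  let ?r = "|D|"
  have r: "Well_order ?r" and field: "Field ?r = D"
    by (simp_all add: card_of_well_order_on Field_card_of)
  have under: "|underS ?r d| <o |D|" if "d \<in> D" for d
    using that by (intro card_of_underS card_of_Card_order) (simp add: field)
  have small: "star_bounding (underS ?r d) \<and> star_bounding (Fpow (underS ?r d))" for d
  \<comment> \<open>The finite case also covers \<open>d\<close> outside \<open>D\<close>, where
    there are no predecessors.\<close>
  proof (cases "finite (underS ?r d)")
    case True
    then have "finite (Fpow (underS ?r d))" by (simp add: Fpow_Pow_finite)
    with True show ?thesis by (simp add: star_bounding_finite)
  next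
    case False
    then have "underS ?r d \<noteq> {}" by auto
    then have "d \<in> Field ?r" by (auto simp: underS_def intro: FieldI2)
    then have d: "d \<in> D" by (simp only: field)
    have "|Fpow (underS ?r d)| <o |D|"
      using card_of_Fpow_infinite[OF False] under[OF d] by (rule ordLeq_ordLess_trans)
    then show ?thesis
      by (intro conjI bounding under d)
  qed
  obtain h where h: "\<And>d. swift (h d)" "\<And>d d'. (d', d) \<in> ?r \<Longrightarrow> le_star d' (h d)"
    "\<And>d E c. E \<in> Fpow (underS ?r d) \<Longrightarrow> infinite (\<Inter>e\<in>E. flat (h e) c) \<Longrightarrow>
        hits (\<Inter>e\<in>E. flat (h e) c) (h d)"
    using swift_family_exists[OF r small[THEN conjunct1] small[THEN conjunct2]] by metis
  have centered: "infinite (\<Inter>e\<in>E. flat (h e) c)" if "finite E" "E \<subseteq> D" for E c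
    using that(2) by (intro flat_centered[OF r h(1,3) that(1)]) (simp_all add: field)
  have trans: "le_star g (h d)" if "le_star g d'" "(d', d) \<in> ?r" for g d d'
    using that(1) h(2)[OF that(2)] unfolding le_star_def by eventually_elim simp
  have refl: "(d, d) \<in> ?r" if "d \<in> D" for d
    using r that field by (auto simp: order_on_defs refl_on_def)
  define S where "S = stripes ` h ` D"
  define X where "X c = S \<union> {x. \<forall>\<^sub>F j in sequentially. x j = c}" for c
  have "menger (top_of_set (\<Pi>\<^sub>E i\<in>I. X c))" if "finite I" for I :: "nat set" and c
  proof (rule menger_finite_power)
    \<comment> \<open>The filter generated by the cofinite sets and the flat sets of colour
      \<open>c\<close>; it is proper because these are centered.\<close>
    let ?F = "INF d\<in>D. inf sequentially (principal (flat (h d) c))"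
    show "?F \<noteq> bot"
    proof (rule INF_filter_not_bot)
      fix E assume E: "E \<subseteq> D" "finite E"
      let ?M = "\<Inter>e\<in>E. flat (h e) c"
      have "inf sequentially (principal ?M) \<noteq> bot"
        using centered[OF E(2,1), of c]
        by (auto simp: trivial_limit_def eventually_inf_principal eventually_sequentially
            infinite_nat_iff_unbounded_le)
      moreover have "inf sequentially (principal ?M) \<le> (INF d\<in>E. inf sequentially (principal (flat (h d) c)))"
        by (intro INF_greatest inf_mono order_refl) auto
      ultimately show "(INF d\<in>E. inf sequentially (principal (flat (h d) c))) \<noteq> bot"
        by (metis bot.extremum_uniqueI)
    qed
    \<comment> \<open>An empty infimum would be the top filter, which is not below
      \<open>sequentially\<close>.\<close>
    have "D \<noteq> {}" using D by (auto simp: dominating_family_def)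
    then show "?F \<le> sequentially" by (auto intro: INF_lower2)
    show "\<exists>K\<subseteq>D. star_bounding K \<and>
        (\<forall>d\<in>D - K. \<forall>\<^sub>F n in ?F. \<forall>j\<in>{n..<g n}. (stripes \<circ> h) d j = c)" for g
    proof -
      \<comment> \<open>The exceptional indices are those before \<open>d'\<close>. From
        \<open>d'\<close> on, \<open>h d\<close> eventually dominates \<open>g\<close>, so on
        \<open>flat (h d) c\<close> the stretch [n, g n) has colour \<open>c\<close> for large
        n.\<close>
      obtain d' where d': "d' \<in> D" "le_star g d'" using D by (auto simp: dominating_family_def)
      have "\<forall>\<^sub>F n in ?F. \<forall>j\<in>{n..<g n}. stripes (h d) j = c" if d: "d \<in> D - underS ?r d'" for d
      proof -
        have "(d', d) \<in> ?r"
          using d d' r field refl by (cases "d = d'") (auto simp: underS_def order_on_defs total_on_def)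
        then have "\<forall>\<^sub>F n in sequentially. g n \<le> h d n"
          using trans d'(2) by (simp add: le_star_def)
        then have "\<forall>\<^sub>F n in inf sequentially (principal (flat (h d) c)). \<forall>j\<in>{n..<g n}. stripes (h d) j = c"
          unfolding eventually_inf_principal by (rule eventually_mono) (auto simp: flat_def)
        moreover have "?F \<le> inf sequentially (principal (flat (h d) c))"
          using d by (intro INF_lower) auto
        ultimately show ?thesis using filter_leD by blast
      qed
      then show ?thesis
        using small[of d'] field
        by (intro exI[of _ "underS ?r d'"]) (auto simp: underS_def dest: FieldI1)
    qed
    show "X c = (stripes \<circ> h) ` D \<union> {x. \<forall>\<^sub>F j in sequentially. x j = c}"
      by (auto simp: X_def S_def)
  qed (fact that)
  then have "menger (product_topology (\<lambda>_. subtopology cantor_space (X c)) {..<n})" for c and n :: nat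
    by (intro menger_product_cantor) simp
  moreover have "\<not> menger (prod_topology (subtopology cantor_space (X False)) (subtopology cantor_space (X True)))"
  proof
    assume "menger (prod_topology (subtopology cantor_space (X False)) (subtopology cantor_space (X True)))"
    then have "menger (top_of_set (X False \<inter> X True))"
      unfolding cantor_space_eq_euclidean by (rule menger_Int_if_menger_prod)
    moreover have "X False \<inter> X True = S"
    proof -
      have "False" if "\<forall>\<^sub>F j in sequentially. \<not> x j" "\<forall>\<^sub>F j in sequentially. x j" for x :: "nat \<Rightarrow> bool"
        using eventually_conj[OF that] by simp
      then show ?thesis by (auto simp: X_def)
    qed
    \<comment> \<open>Reflexivity of the order gives that each \<open>d\<close> is eventually
      dominated by \<open>h d\<close>.\<close>
    moreover have "dominating_family (h ` D)"
      using D trans refl unfolding dominating_family_def by blast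
    ultimately show False
      using not_menger_stripes[of "h ` D"] h(1) by (auto simp: S_def)
  qed
  ultimately show ?thesis
    by (intro exI[of _ "X False"] exI[of _ "X True"] conjI allI)
qed

end
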